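(* Let $(K,P,N)$ and $(\hat K,\hat P,\hat N)$ be finite elements of the same class $C^k$, with $\dim P=\nu$, let $F:K\to\hat K$ be the invertible geometric (affine) mapping, and suppose that $F(K)=\hat K$ and $F^*(\hat P)=P$. Let $\Psi=(\psi_1,\dots,\psi_\nu)^T$ and $\hat\Psi=(\hat\psi_1,\dots,\hat\psi_\nu)^T$ be the nodal bases of $(K,P,N)$ and $(\hat K,\hat P,\hat N)$ respectively. Let $M\in\mathbb{R}^{\nu\times\nu}$ be the invertible matrix with $$\Psi = M F^*(\hat\Psi), \qquad\text{i.e. } \psi_i=\sum_{j=1}^\nu M_{ij}F^*(\hat\psi_j)\ \text{ for } 1\le i\le\nu,$$ and let $V\in\mathbb{R}^{\nu\times\nu}$ be the invertible matrix with $$\hat\pi\hat N = V F_*(\pi N), \qquad\text{i.e. } \hat\pi\hat n_i=\sum_{j=1}^\nu V_{ij}F_*(\pi n_j)\ \text{ in } \hat P' \text{ for } 1\le i\le\nu.$$ Then $M=V^T$.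
   Context: For a bounded domain $\Omega\subset\mathbb{R}^d$, $C_b^k(\Omega)$ is the space of functions on $\Omega$ with continuous and bounded derivatives up to and including order $k$, and $C_b^k(\Omega)'$ is its topological dual. A finite element (of class $C^k$) is a triple $(K,P,N)$ where $K\subset\mathbb{R}^d$ is a bounded domain, $P\subset C_b^k(K)$ is a finite-dimensional function space of dimension $\nu$, and $N=\{n_i\}_{i=1}^\nu\subset C_b^k(K)'$ is a (fixed, ordered) collection of linearly independent functionals (nodes) whose restrictions to $P$ form a basis of the dual space $P'$. $N$ is also regarded as the column vector $(n_1,\dots,n_\nu)^T$. The nodal basis of $P$ is the set $\{\psi_i\}_{i=1}^\nu\subset P$ with $n_i(\psi_j)=\delta_{ij}$. The same notation with hats is used for the reference element $(\hat K,\hat P,\hat N)$. For $n\in C_b^k(K)'$, $\pi n\in P'$ denotes the restriction of $n$ to $P$; for $\hat n\in C_b^k(\hat K)'$, $\hat\pi\hat n\in\hat P'$ denotes the restriction of $\hat n$ to $\hat P$; both act entrywise on vectors of functionals. The pull-back $F^*:C_b^k(\hat K)\to C_b^k(K)$ is $F^*(\hat f)=\hat f\circ F$, and the push-forward is $F_*(n)=n\circ F^*$, mapping $C_b^k(K)'$ to $C_b^k(\hat K)'$ and, by the same formula, $P'$ to $\hat P'$. Both act entrywise on vectors. Under the hypotheses of the claim, $F^*(\hat\Psi)$ is a basis of $P$, and $\hat\pi\hat N$ and $F_*(\pi N)$ are both bases of $\hat P'$, so $M$ and $V$ exist, are unique and are invertible. *)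

theory Defs
  imports "HOL-Analysis.Analysis" "HOL-Library.Function_Algebras"
begin

text \<open>
  Pointwise scalar multiplication makes real-valued functions, and functionals on them, real vector
  spaces, so that \<^const>\<open>subspace\<close>, \<^const>\<open>span\<close>, \<^const>\<open>independent\<close> and \<^const>\<open>dim\<close> apply to both.
\<close>

instantiation "fun" :: (type, real_vector) real_vector
begin

definition scaleR_fun :: "real \<Rightarrow> ('a \<Rightarrow> 'b) \<Rightarrow> 'a \<Rightarrow> 'b"
  where "scaleR_fun c f = (\<lambda>x. c *\<^sub>R f x)"

instance
  by standard (auto simp: scaleR_fun_def fun_eq_iff scaleR_add_right scaleR_add_left)

end

text \<open>
  Functions on a domain \<open>K\<close>, and functionals on a function space \<open>X\<close>, are represented by total
  functions that vanish outside \<open>K\<close> and \<open>X\<close> respectively. Equality of representatives is then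
  equality on \<open>K\<close> (on \<open>X\<close>), and the function spaces and dual spaces are linear subspaces.
\<close>

type_synonym 'd scalar_field = "real^'d \<Rightarrow> real"
type_synonym 'd nodal_functional = "'d scalar_field \<Rightarrow> real"

definition bounded_domain :: "(real^'d) set \<Rightarrow> bool"
  where "bounded_domain K \<longleftrightarrow> open K \<and> connected K \<and> K \<noteq> {} \<and> bounded K"


subsection \<open>The spaces of functions with bounded continuous derivatives\<close>

text \<open>
  A list of coordinate directions encodes an iterated partial derivative; the head of the list is
  the outermost one, and the length is the order.
\<close>

definition has_partial :: "'d::finite \<Rightarrow> 'd scalar_field \<Rightarrow> real^'d \<Rightarrow> bool"
  where "has_partial i f x \<longleftrightarrow> (\<lambda>t. f (x + t *\<^sub>R axis i 1)) differentiable (at 0)"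

definition partial :: "'d::finite \<Rightarrow> 'd scalar_field \<Rightarrow> 'd scalar_field"
  where "partial i f = (\<lambda>x. deriv (\<lambda>t. f (x + t *\<^sub>R axis i 1)) 0)"

fun iter_partial :: "'d::finite list \<Rightarrow> 'd scalar_field \<Rightarrow> 'd scalar_field"
  where
    "iter_partial [] f = f"
  | "iter_partial (i # is) f = partial i (iter_partial is f)"

definition Cb :: "nat \<Rightarrow> (real^'d) set \<Rightarrow> 'd::finite scalar_field set"
  where "Cb k K = {f.
      (\<forall>x. x \<notin> K \<longrightarrow> f x = 0)
    \<and> (\<forall>is i. length is < k \<longrightarrow> (\<forall>x\<in>K. has_partial i (iter_partial is f) x))
    \<and> (\<forall>is. length is \<le> k \<longrightarrow>
          continuous_on K (iter_partial is f) \<and> bounded (iter_partial is f ` K))}"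

definition Cb_norm :: "nat \<Rightarrow> (real^'d) set \<Rightarrow> 'd::finite scalar_field \<Rightarrow> real"
  where "Cb_norm k K f = (SUP (is, x) \<in> {is. length is \<le> k} \<times> K. \<bar>iter_partial is f x\<bar>)"

text \<open>
  The topological dual of a subspace \<open>X\<close> of \<open>Cb k K\<close> with the norm of \<open>Cb k K\<close>. For a
  finite-dimensional \<open>X\<close>, such as the space of a finite element, it is the whole algebraic dual.
\<close>

definition top_dual :: "nat \<Rightarrow> (real^'d) set \<Rightarrow> 'd::finite scalar_field set
    \<Rightarrow> 'd nodal_functional set"
  where "top_dual k K X = {n.
      (\<forall>f. f \<notin> X \<longrightarrow> n f = 0)
    \<and> (\<forall>f\<in>X. \<forall>g\<in>X. n (f + g) = n f + n g)
    \<and> (\<forall>c. \<forall>f\<in>X. n (c *\<^sub>R f) = c * n f)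
    \<and> (\<exists>C. \<forall>f\<in>X. \<bar>n f\<bar> \<le> C * Cb_norm k K f)}"


subsection \<open>Finite elements\<close>

text \<open>
  Injectivity is part of linear independence of a family, since \<^term>\<open>range (($) v)\<close> forgets
  repeated entries.
\<close>

definition independent_family :: "('b::real_vector)^'n \<Rightarrow> bool"
  where "independent_family v \<longleftrightarrow> inj (($) v) \<and> independent (range (($) v))"

definition basis_family :: "('b::real_vector)^'n \<Rightarrow> 'b set \<Rightarrow> bool"
  where "basis_family v S \<longleftrightarrow> independent_family v \<and> span (range (($) v)) = S"

text \<open>The restriction \<open>\<pi> n\<close> of a functional to \<open>P\<close>.\<close>

definition restr :: "'d scalar_field set \<Rightarrow> 'd nodal_functional \<Rightarrow> 'd nodal_functional"
  where "restr P n = (\<lambda>f. if f \<in> P then n f else 0)"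

text \<open>
  The dimension of the element is the cardinality of the type \<open>'n\<close> that indexes the nodes.
\<close>

definition finite_element :: "nat \<Rightarrow> (real^'d) set \<Rightarrow> 'd::finite scalar_field set
    \<Rightarrow> ('d nodal_functional)^'n::finite \<Rightarrow> bool"
  where "finite_element k K P N \<longleftrightarrow>
      bounded_domain K
    \<and> subspace P \<and> P \<subseteq> Cb k K \<and> (\<exists>B. finite B \<and> span B = P) \<and> dim P = CARD('n)
    \<and> (\<forall>i. N $ i \<in> top_dual k K (Cb k K))
    \<and> independent_family N
    \<and> basis_family (\<chi> i. restr P (N $ i)) (top_dual k K P)"

definition nodal_basis :: "'d::finite scalar_field set \<Rightarrow> ('d nodal_functional)^'n::finite
    \<Rightarrow> ('d scalar_field)^'n \<Rightarrow> bool"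
  where "nodal_basis P N \<Psi> \<longleftrightarrow>
      (\<forall>i. \<Psi> $ i \<in> P) \<and> (\<forall>i j. (N $ i) (\<Psi> $ j) = (if i = j then 1 else 0))"


subsection \<open>Pull-back and push-forward\<close>

definition affine_bijection ::
    "(real^'d::finite) set \<Rightarrow> (real^'d) set \<Rightarrow> (real^'d \<Rightarrow> real^'d) \<Rightarrow> bool"
  where "affine_bijection K K' F \<longleftrightarrow>
      (\<exists>(A :: real^'d^'d) b. \<forall>x\<in>K. F x = A *v x + b) \<and> bij_betw F K K'"

definition pull_back ::
    "(real^'d) set \<Rightarrow> (real^'d \<Rightarrow> real^'d) \<Rightarrow> 'd scalar_field \<Rightarrow> 'd scalar_field"
  where "pull_back K F f = (\<lambda>x. if x \<in> K then f (F x) else 0)"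

text \<open>
  The push-forward \<open>n \<circ> F\<^sup>*\<close> as a functional on \<open>X\<close>; here \<open>X\<close> is the function space on the
  reference domain, that is, \<open>Cb k (F ` K)\<close> for functionals on \<open>Cb k K\<close> and the reference space
  for functionals on \<open>P\<close>.
\<close>

definition push_forward :: "'d scalar_field set \<Rightarrow> (real^'d) set \<Rightarrow> (real^'d \<Rightarrow> real^'d)
    \<Rightarrow> 'd nodal_functional \<Rightarrow> 'd nodal_functional"
  where "push_forward X K F n = (\<lambda>f. if f \<in> X then n (pull_back K F f) else 0)"

end

theory Submission
  imports Defs
begin

text \<open>
  Both matrices are governed by the square matrix \<open>A\<close> with entries \<open>n\<^sub>i(F\<^sup>*(\<psi>h\<^sub>j))\<close>, the nodes of the
  element evaluated on the pulled-back reference nodal basis. Applying \<open>n\<^sub>i\<close> to the expansion of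
  \<open>\<psi>\<^sub>l\<close> (linearity: \<open>top_dual_linear_combination\<close>) and using \<open>n\<^sub>i(\<psi>\<^sub>l) = \<delta>\<^sub>i\<^sub>l\<close> gives \<open>A M\<^sup>T = I\<close>. Evaluating the expansion of the reference
  node \<open>nh\<^sub>i\<close> at \<open>\<psi>h\<^sub>l\<close>, where the push-forward of \<open>n\<^sub>j\<close> takes the value \<open>n\<^sub>j(F\<^sup>*(\<psi>h\<^sub>l))\<close> by
  definition, gives \<open>V A = I\<close>. Thus \<open>V\<close> is a left inverse and \<open>M\<^sup>T\<close> a right inverse of the same matrix,
  and the two agree: \<open>V = V (A M\<^sup>T) = (V A) M\<^sup>T = M\<^sup>T\<close>.
\<close>

lemma sum_fun_apply:
  fixes f :: "'j \<Rightarrow> 'a \<Rightarrow> 'b::comm_monoid_add"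
  shows "(\<Sum>j\<in>J. f j) x = (\<Sum>j\<in>J. f j x)"
  by (induction J rule: infinite_finite_induct) auto

text \<open>
  Functionals in \<^const>\<open>top_dual\<close> are linear only on \<open>X\<close>, and are set to zero off it, so the
  functions must lie in \<open>X\<close> and \<open>X\<close> must be closed under linear combinations.
\<close>

lemma top_dual_linear_combination:
  assumes n: "n \<in> top_dual k K X" and X: "subspace X" and f: "\<And>j. j \<in> J \<Longrightarrow> f j \<in> X"
  shows "n (\<Sum>j\<in>J. c j *\<^sub>R f j) = (\<Sum>j\<in>J. c j * n (f j))"
proof -
  have add: "n (g + h) = n g + n h" if "g \<in> X" "h \<in> X" for g h
    using n that by (auto simp: top_dual_def)
  have scale: "n (a *\<^sub>R g) = a * n g" if "g \<in> X" for a g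
    using n that by (auto simp: top_dual_def)
  have zero: "n 0 = 0"
    using scale[of 0 0] subspace_0[OF X] by simp
  show ?thesis
    using f
  proof (induction J rule: infinite_finite_induct)
    case (insert j J)
    have "(\<Sum>i\<in>J. c i *\<^sub>R f i) \<in> X"
      using insert.prems by (intro subspace_sum[OF X] subspace_scale[OF X]) auto
    then have "n (c j *\<^sub>R f j + (\<Sum>i\<in>J. c i *\<^sub>R f i))
        = c j * n (f j) + n (\<Sum>i\<in>J. c i *\<^sub>R f i)"
      using insert.prems by (subst add) (auto intro: subspace_scale[OF X] simp: scale)
    moreover have "n (\<Sum>i\<in>J. c i *\<^sub>R f i) = (\<Sum>i\<in>J. c i * n (f i))"
      using insert by blast
    ultimately show ?case
      by (simp only: sum.insert[OF insert.hyps])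
  qed (simp_all add: zero)
qed

lemma finite_element_restr_in_dual:
  assumes "finite_element k K P N"
  shows "restr P (N $ i) \<in> top_dual k K P"
proof -
  have "restr P (N $ i) \<in> span (range (($) (\<chi> i. restr P (N $ i))))"
    by (rule span_base) (auto intro: image_eqI[of _ _ i])
  then show ?thesis
    using assms by (simp add: finite_element_def basis_family_def)
qed

theorem theorem3p1:
  fixes k :: nat
    and K Kh :: "(real^'d::finite) set"
    and P Ph :: "'d scalar_field set"
    and N Nh :: "('d nodal_functional)^'n::finite"
    and F :: "real^'d \<Rightarrow> real^'d"
    and \<Psi> \<Psi>h :: "('d scalar_field)^'n"
    and M V :: "real^'n^'n"
  assumes "finite_element k K P N"
    and "finite_element k Kh Ph Nh"
    and "affine_bijection K Kh F"
    and "F ` K = Kh"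
    and "pull_back K F ` Ph = P"
    and "nodal_basis P N \<Psi>"
    and "nodal_basis Ph Nh \<Psi>h"
    and "invertible M"
    and "\<forall>i. \<Psi> $ i = (\<Sum>j\<in>UNIV. M $ i $ j *\<^sub>R pull_back K F (\<Psi>h $ j))"
    and "invertible V"
    and "\<forall>i. restr Ph (Nh $ i) =
           (\<Sum>j\<in>UNIV. V $ i $ j *\<^sub>R push_forward Ph K F (restr P (N $ j)))"
  shows "M = transpose V"
proof -
  define A :: "real^'n^'n" where "A = (\<chi> i j. (N $ i) (pull_back K F (\<Psi>h $ j)))"
  have \<Psi>h_in: "\<Psi>h $ j \<in> Ph" for j
    using assms(7) by (simp add: nodal_basis_def)
  then have pulled_in: "pull_back K F (\<Psi>h $ j) \<in> P" for j
    using assms(5) by blast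
  have P: "subspace P"
    using assms(1) by (simp add: finite_element_def)
  have "(A ** transpose M) $ i $ l = (mat 1 :: real^'n^'n) $ i $ l" for i l
  proof -
    have \<Psi>_in: "\<Psi> $ l \<in> P" and dual: "(N $ i) (\<Psi> $ l) = (if i = l then 1 else 0)"
      using assms(6) by (simp_all add: nodal_basis_def)
    have "(A ** transpose M) $ i $ l
        = (\<Sum>j\<in>UNIV. M $ l $ j * restr P (N $ i) (pull_back K F (\<Psi>h $ j)))"
      by (simp add: matrix_matrix_mult_def transpose_def A_def restr_def pulled_in mult.commute)
    also have "\<dots> = restr P (N $ i) (\<Sum>j\<in>UNIV. M $ l $ j *\<^sub>R pull_back K F (\<Psi>h $ j))"
      by (rule top_dual_linear_combination[symmetric,
            OF finite_element_restr_in_dual[OF assms(1)] P pulled_in])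
    also have "\<dots> = restr P (N $ i) (\<Psi> $ l)"
      using assms(9) by simp
    also have "\<dots> = (mat 1 :: real^'n^'n) $ i $ l"
      using \<Psi>_in dual by (simp add: restr_def mat_def)
    finally show ?thesis .
  qed
  then have AM: "A ** transpose M = mat 1"
    by (simp add: vec_eq_iff)
  have "(V ** A) $ i $ l = (mat 1 :: real^'n^'n) $ i $ l" for i l
  proof -
    have dual: "(Nh $ i) (\<Psi>h $ l) = (if i = l then 1 else 0)"
      using assms(7) by (simp add: nodal_basis_def)
    have "(V ** A) $ i $ l
        = (\<Sum>j\<in>UNIV. V $ i $ j *\<^sub>R push_forward Ph K F (restr P (N $ j))) (\<Psi>h $ l)"
      by (simp add: matrix_matrix_mult_def A_def sum_fun_apply scaleR_fun_def push_forward_def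
          restr_def \<Psi>h_in pulled_in)
    also have "\<dots> = restr Ph (Nh $ i) (\<Psi>h $ l)"
      using assms(11) by simp
    also have "\<dots> = (mat 1 :: real^'n^'n) $ i $ l"
      using \<Psi>h_in dual by (simp add: restr_def mat_def)
    finally show ?thesis .
  qed
  then have VA: "V ** A = mat 1"
    by (simp add: vec_eq_iff)
  have "V = V ** (A ** transpose M)"
    by (simp add: AM)
  also have "\<dots> = transpose M"
    by (simp add: matrix_mul_assoc VA)
  finally show ?thesis
    by (simp add: transpose_transpose)
qed

end
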